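(* Let $q$ be a power of a prime $p$, $n\ge1$, and $0\le r\le n$. Let $\mathcal{F}_0$ be the set of points and $\mathcal{F}_r$ the set of $r$-flats (cosets of $r$-dimensional linear subspaces) of the affine space $\mathrm{AG}(n,q)=\mathbb{F}_q^n$. Let $A_1$ be the integer $|\mathcal{F}_r|\times|\mathcal{F}_0|$ $(0,1)$-matrix whose $(Y,Z)$-entry is $1$ iff the point $Z$ lies in the flat $Y$. Then all invariant factors of $A_1$ over $\mathbb{Z}$ are powers of $p$. *)

theory Defs
  imports "HOL-Analysis.Cartesian_Space" "Jordan_Normal_Form.Matrix"
    "HOL-Computational_Algebra.Primes"
begin

definition affine_flats :: "nat \<Rightarrow> ('a :: field ^ 'n) set set" where
  "affine_flats r = {(\<lambda>v. a + v) ` L | a L. vec.subspace L \<and> vec.dim L = r}"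

definition incidence_mat :: "'b set list \<Rightarrow> 'b list \<Rightarrow> int mat" where
  "incidence_mat Ys Zs =
     mat (length Ys) (length Zs) (\<lambda>(i, j). if Zs ! j \<in> Ys ! i then 1 else 0)"

text \<open>The diagonal entries are normalised to be nonnegative, so that over the
  integers the form is unique; since \<open>0 dvd x\<close> forces \<open>x = 0\<close>, zero entries come last.\<close>

definition smith_normal_form_of :: "int mat \<Rightarrow> int mat \<Rightarrow> bool" where
  "smith_normal_form_of A S \<longleftrightarrow>
     (\<exists>P Q. P \<in> carrier_mat (dim_row A) (dim_row A) \<and> invertible_mat P \<and>
            Q \<in> carrier_mat (dim_col A) (dim_col A) \<and> invertible_mat Q \<and>
            S = P * A * Q) \<and>
     diagonal_mat S \<and>
     (\<forall>i < min (dim_row S) (dim_col S). 0 \<le> S $$ (i, i)) \<and>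
     (\<forall>i. Suc i < min (dim_row S) (dim_col S) \<longrightarrow> S $$ (i, i) dvd S $$ (Suc i, Suc i))"

definition invariant_factors :: "int mat \<Rightarrow> int set" where
  "invariant_factors A =
     {S $$ (i, i) | S i. smith_normal_form_of A S \<and>
                         i < min (dim_row S) (dim_col S) \<and> S $$ (i, i) \<noteq> 0}"

end

theory Submission
  imports Defs
begin

text \<open>Inside an \<open>(r + 2)\<close>-flat, \<open>q\<close> times the indicator of an \<open>r\<close>-flat is an integer combination of
  indicators of \<open>(r + 1)\<close>-flats. Hence for \<open>r < n\<close> the vector \<open>q\<^sup>r \<delta>\<^sub>z\<close> lies in the row lattice of the
  incidence matrix \<open>A\<close> for every point \<open>z\<close>, that is, \<open>B A = q\<^sup>r I\<close> for some integer matrix \<open>B\<close>, and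
  passing to the Smith normal form shows that every invariant factor divides \<open>q\<^sup>r\<close>. For \<open>r = n\<close> the
  matrix is a single row of ones.\<close>

section \<open>The integer lattice generated by the flats of a fixed dimension\<close>

text \<open>This is the row lattice of the incidence matrix, with rows read as functions on points,
  so that no enumeration of flats or points enters before the main theorem.\<close>

definition flat_span :: "nat \<Rightarrow> ('a :: {field, finite} ^ 'n :: finite \<Rightarrow> int) set" where
  "flat_span r = {f. \<exists>c. \<forall>x. f x = (\<Sum>Y\<in>affine_flats r. c Y * of_bool (x \<in> Y))}"

lemma flat_spanI:
  assumes "\<And>x. f x = (\<Sum>Y\<in>affine_flats r. c Y * of_bool (x \<in> Y))"
  shows "f \<in> flat_span r"
  using assms by (auto simp: flat_span_def)

lemma flat_span_flat:
  fixes Y :: "('a :: {field, finite} ^ 'n :: finite) set"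
  assumes "Y \<in> affine_flats r"
  shows "(\<lambda>x. of_bool (x \<in> Y)) \<in> flat_span r"
proof (rule flat_spanI[where c = "\<lambda>Z. of_bool (Z = Y)"])
  fix x
  have "(\<Sum>Z\<in>affine_flats r. of_bool (Z = Y) * of_bool (x \<in> Z))
      = (\<Sum>Z\<in>affine_flats r. if Z = Y then of_bool (x \<in> Y) else (0 :: int))"
    by (rule sum.cong) auto
  then show "of_bool (x \<in> Y) = (\<Sum>Z\<in>affine_flats r. of_bool (Z = Y) * of_bool (x \<in> Z) :: int)"
    using assms by simp
qed

lemma flat_span_scale:
  assumes "f \<in> flat_span r"
  shows "(\<lambda>x. d * f x) \<in> flat_span r"
proof -
  obtain c where "\<And>x. f x = (\<Sum>Y\<in>affine_flats r. c Y * of_bool (x \<in> Y))"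
    using assms by (auto simp: flat_span_def)
  then show ?thesis
    by (intro flat_spanI[where c = "\<lambda>Y. d * c Y"]) (simp only: sum_distrib_left mult.assoc)
qed

lemma flat_span_diff:
  assumes "f \<in> flat_span r" "g \<in> flat_span r"
  shows "(\<lambda>x. f x - g x) \<in> flat_span r"
proof -
  obtain c e where "\<And>x. f x = (\<Sum>Y\<in>affine_flats r. c Y * of_bool (x \<in> Y))"
    "\<And>x. g x = (\<Sum>Y\<in>affine_flats r. e Y * of_bool (x \<in> Y))"
    using assms by (auto simp: flat_span_def)
  then show ?thesis
    by (intro flat_spanI[where c = "\<lambda>Y. c Y - e Y"]) (simp add: sum_subtractf algebra_simps)
qed

lemma flat_span_sum:
  assumes "\<And>i. i \<in> I \<Longrightarrow> f i \<in> flat_span r"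
  shows "(\<lambda>x. \<Sum>i\<in>I. f i x) \<in> flat_span r"
proof -
  have "\<forall>i\<in>I. \<exists>c. \<forall>x. f i x = (\<Sum>Y\<in>affine_flats r. c Y * of_bool (x \<in> Y))"
    using assms by (auto simp: flat_span_def)
  then obtain c where
    "\<And>i x. i \<in> I \<Longrightarrow> f i x = (\<Sum>Y\<in>affine_flats r. c i Y * of_bool (x \<in> Y))"
    by metis
  then have "(\<Sum>i\<in>I. f i x) = (\<Sum>Y\<in>affine_flats r. (\<Sum>i\<in>I. c i Y) * of_bool (x \<in> Y))" for x
    by (subst sum_distrib_right, subst sum.swap) (rule sum.cong, auto)
  then show ?thesis
    by (rule flat_spanI)
qed

section \<open>Subspaces, their translates and the covering identity\<close>

lemma mem_translate_iff:
  fixes t x :: "'a :: ab_group_add"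
  shows "x \<in> (\<lambda>v. t + v) ` L \<longleftrightarrow> x - t \<in> L"
  by (auto simp: image_iff) (metis add.commute diff_add_cancel)

lemma exists_not_in_subspace:
  fixes U :: "('a :: field ^ 'n :: finite) set"
  assumes "vec.subspace U" "vec.dim U < CARD('n)"
  obtains a where "a \<notin> U"
proof -
  have "U \<noteq> UNIV"
    using assms(2) by (auto simp: card_cart_basis)
  then show ?thesis
    using that by blast
qed

lemma translate_span_insert_flat:
  fixes U :: "('a :: field ^ 'n :: finite) set"
  assumes "vec.subspace U" "v \<notin> U"
  shows "(\<lambda>x. t + x) ` vec.span (insert v U) \<in> affine_flats (Suc (vec.dim U))"
proof -
  have "v \<notin> vec.span U"
    using assms by (metis vec.span_eq_iff)
  then have "vec.dim (vec.span (insert v U)) = Suc (vec.dim U)"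
    by (simp add: vec.dim_insert)
  then show ?thesis
    unfolding affine_flats_def using vec.subspace_span by blast
qed

text \<open>The hyperplanes of \<open>U + \<langle>a, b\<rangle>\<close> through \<open>U\<close> cover \<open>U\<close> exactly \<open>q + 1\<close> times and every
  other point once; the translates of \<open>U + \<langle>b\<rangle>\<close> cover everything once. The hyperplane
  \<open>U + \<langle>b\<rangle>\<close> itself occurs in both families and has been cancelled.\<close>

lemma indicator_subspace_eq:
  fixes U :: "('a :: {field, finite} ^ 'n :: finite) set"
  assumes U: "vec.subspace U" and a: "a \<notin> U" and b: "b \<notin> vec.span (insert a U)"
  shows "int CARD('a) * of_bool (y \<in> U) =
    (\<Sum>c\<in>UNIV. of_bool (y \<in> vec.span (insert (a + c *s b) U))) -
    (\<Sum>c\<in>-{0}. of_bool (y - c *s a \<in> vec.span (insert b U)))"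
proof -
  have sU: "vec.span U = U"
    using U by (simp add: vec.span_eq_iff)
  have mem: "x \<in> vec.span (insert v U) \<longleftrightarrow> (\<exists>k. x - k *s v \<in> U)" for x v
    using vec.span_breakdown_eq[of x v U] by (simp add: sU)
  have "y - k *s (a + c *s b) = y - (k *s a + (k * c) *s b)" for k c
    by (simp add: vec_eq_iff algebra_simps)
  then have mem_ab: "y \<in> vec.span (insert (a + c *s b) U)
      \<longleftrightarrow> (\<exists>k. y - (k *s a + (k * c) *s b) \<in> U)" for c
    unfolding mem by (simp only:)
  have mem_b: "y - c *s a \<in> vec.span (insert b U)
      \<longleftrightarrow> (\<exists>k. y - (c *s a + k *s b) \<in> U)" for c
    unfolding mem by (simp only: diff_diff_eq)
  \<comment> \<open>Independence of \<open>a\<close> and \<open>b\<close> modulo \<open>U\<close>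
    gives each point of \<open>U + <a, b>\<close> unique coordinates, which turns the identity into
    a count over field elements.\<close>
  have indep: "\<alpha> = 0 \<and> \<beta> = 0" if "\<alpha> *s a + \<beta> *s b \<in> U" for \<alpha> \<beta>
  proof -
    have "\<beta> = 0"
    proof (rule ccontr)
      assume "\<beta> \<noteq> 0"
      have "(1 / \<beta>) *s (\<alpha> *s a + \<beta> *s b) \<in> U"
        using that by (rule vec.subspace_scale[OF U])
      moreover have "(1 / \<beta>) *s (\<alpha> *s a + \<beta> *s b) = b - (- (\<alpha> / \<beta>)) *s a"
        using \<open>\<beta> \<noteq> 0\<close> by (simp add: vec_eq_iff field_simps)
      ultimately show False
        using b mem by metis
    qed
    moreover have "\<alpha> = 0"
    proof (rule ccontr)
      assume "\<alpha> \<noteq> 0"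
      have "(1 / \<alpha>) *s (\<alpha> *s a + \<beta> *s b) \<in> U"
        using that by (rule vec.subspace_scale[OF U])
      moreover have "(1 / \<alpha>) *s (\<alpha> *s a + \<beta> *s b) = a"
        using \<open>\<alpha> \<noteq> 0\<close> \<open>\<beta> = 0\<close> by (simp add: vec_eq_iff)
      ultimately show False
        using a by simp
    qed
    ultimately show ?thesis by simp
  qed
  show ?thesis
  proof (cases "\<exists>\<alpha> \<beta>. y - (\<alpha> *s a + \<beta> *s b) \<in> U")
    case True
    then obtain \<alpha> \<beta> where y: "y - (\<alpha> *s a + \<beta> *s b) \<in> U" by blast
    have uniq: "y - (\<gamma> *s a + \<delta> *s b) \<in> U \<longleftrightarrow> \<gamma> = \<alpha> \<and> \<delta> = \<beta>" for \<gamma> \<delta>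
    proof
      assume "y - (\<gamma> *s a + \<delta> *s b) \<in> U"
      then have "(y - (\<alpha> *s a + \<beta> *s b)) - (y - (\<gamma> *s a + \<delta> *s b)) \<in> U"
        using y U vec.subspace_diff by blast
      moreover have "(y - (\<alpha> *s a + \<beta> *s b)) - (y - (\<gamma> *s a + \<delta> *s b))
          = (\<gamma> - \<alpha>) *s a + (\<delta> - \<beta>) *s b"
        by (simp add: vec_eq_iff algebra_simps)
      ultimately show "\<gamma> = \<alpha> \<and> \<delta> = \<beta>"
        using indep by fastforce
    qed (use y in simp)
    have y_U: "y \<in> U \<longleftrightarrow> \<alpha> = 0 \<and> \<beta> = 0"
      using uniq[of 0 0] by auto
    have 1: "y \<in> vec.span (insert (a + c *s b) U) \<longleftrightarrow> \<alpha> * c = \<beta>" for c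
      by (auto simp: mem_ab uniq)
    have 2: "y - c *s a \<in> vec.span (insert b U) \<longleftrightarrow> c = \<alpha>" for c
      by (auto simp: mem_b uniq)
    \<comment> \<open>If \<open>\<alpha> = 0\<close>, the second sum vanishes because it omits
      \<open>c = 0\<close>, and the first counts every \<open>c\<close> or none according to whether
      \<open>\<beta> = 0\<close>. If \<open>\<alpha> \<noteq> 0\<close>, each sum has exactly one
      nonzero term, at \<open>c = \<beta> / \<alpha>\<close> and at \<open>c = \<alpha>\<close>, and
      these cancel.\<close>
    show ?thesis
    proof (cases "\<alpha> = 0")
      case True
      then show ?thesis
        by (auto simp: 1 2 y_U of_bool_def intro!: sum.neutral)
    next
      case False
      then have "\<alpha> * c = \<beta> \<longleftrightarrow> c = \<beta> / \<alpha>" for c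
        by (auto simp: field_simps)
      then show ?thesis
        using False by (simp add: 1 2 y_U of_bool_def)
    qed
  next
    case False
    have 1: "y \<notin> vec.span (insert (a + c *s b) U)" for c
      using False by (simp add: mem_ab)
    have 2: "y - c *s a \<notin> vec.span (insert b U)" for c
      using False by (simp add: mem_b)
    have "y - (0 *s a + 0 *s b) = y"
      by simp
    then have "y \<notin> U"
      using False by metis
    then show ?thesis
      by (simp add: 1 2)
  qed
qed

section \<open>Raising the dimension at the cost of a factor \<open>CARD('a)\<close>\<close>

text \<open>The covering identity is applied at \<open>x - t\<close>, where \<open>Y\<close> is the
  translate of \<open>U\<close> by \<open>t\<close>. The bound on \<open>r\<close> leaves room for
  two directions independent modulo \<open>U\<close>.\<close>

lemma flat_span_Suc_flat:
  fixes Y :: "('a :: {field, finite} ^ 'n :: finite) set"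
  assumes Y: "Y \<in> affine_flats r" and r: "Suc r < CARD('n)"
  shows "(\<lambda>x. int CARD('a) * of_bool (x \<in> Y)) \<in> flat_span (Suc r)"
proof -
  obtain t U where U: "vec.subspace U" "vec.dim U = r" and Y_eq: "Y = (\<lambda>v. t + v) ` U"
    using Y by (auto simp: affine_flats_def)
  have sU: "vec.span U = U"
    using U by (simp add: vec.span_eq_iff)
  obtain a where a: "a \<notin> U"
    using exists_not_in_subspace U r by (metis Suc_lessD)
  have "vec.dim (vec.span (insert a U)) = Suc r"
    using a U by (simp add: vec.dim_insert sU)
  then obtain b where b: "b \<notin> vec.span (insert a U)"
    using exists_not_in_subspace[OF vec.subspace_span] r by metis
  have "U \<subseteq> vec.span (insert a U)"
    by (meson dual_order.trans subset_insertI vec.span_superset)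
  then have bU: "b \<notin> U"
    using b by blast
  \<comment> \<open>Needed so that each span of \<open>U\<close> and \<open>a + c *s b\<close> has
    dimension exactly \<open>Suc r\<close>.\<close>
  have abU: "a + c *s b \<notin> U" for c
  proof
    assume "a + c *s b \<in> U"
    then have "a + c *s b - a \<in> vec.span (insert a U)"
      using \<open>U \<subseteq> _\<close> by (intro vec.span_diff) (auto intro: vec.span_base)
    then have "c *s b \<in> vec.span (insert a U)"
      by simp
    \<comment> \<open>As \<open>1 / 0 = 0\<close>, the scaling is valid for every \<open>c\<close>;
      for \<open>c \<noteq> 0\<close> it would put \<open>b\<close> into the span.\<close>
    then have "(1 / c) *s (c *s b) \<in> vec.span (insert a U)"
      by (rule vec.span_scale)
    then have "c = 0"
      using b by (auto simp: vector_smult_assoc split: if_splits)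
    then show False
      using \<open>a + c *s b \<in> U\<close> a by simp
  qed
  have "(\<lambda>x. (\<Sum>c\<in>UNIV. of_bool (x \<in> (\<lambda>v. t + v) ` vec.span (insert (a + c *s b) U)))
      - (\<Sum>c\<in>-{0}. of_bool (x \<in> (\<lambda>v. (t + c *s a) + v) ` vec.span (insert b U))))
      \<in> flat_span (Suc r)"
    using translate_span_insert_flat[OF U(1)] abU bU U(2)
    by (intro flat_span_diff flat_span_sum flat_span_flat) auto
  then show ?thesis
    unfolding Y_eq mem_translate_iff indicator_subspace_eq[OF U(1) a b]
    by (simp add: diff_diff_eq)
qed

lemma flat_span_Suc:
  fixes f :: "'a :: {field, finite} ^ 'n :: finite \<Rightarrow> int"
  assumes f: "f \<in> flat_span r" and r: "Suc r < CARD('n)"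
  shows "(\<lambda>x. int CARD('a) * f x) \<in> flat_span (Suc r)"
proof -
  obtain c where c: "\<And>x. f x = (\<Sum>Y\<in>affine_flats r. c Y * of_bool (x \<in> Y))"
    using f by (auto simp: flat_span_def)
  have "(\<lambda>x. \<Sum>Y\<in>affine_flats r. c Y * (int CARD('a) * of_bool (x \<in> Y))) \<in> flat_span (Suc r)"
    using r by (intro flat_span_sum flat_span_scale flat_span_Suc_flat)
  then show ?thesis
    unfolding c by (simp only: sum_distrib_left mult.left_commute)
qed

text \<open>Points are the 0-flats, and each step up in dimension costs one factor
  \<open>CARD('a)\<close>. A step needs its target dimension below \<open>CARD('n)\<close>, so the
  induction ends one short of the whole space.\<close>

lemma flat_span_point:
  fixes z :: "'a :: {field, finite} ^ 'n :: finite"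
  assumes "r < CARD('n)"
  shows "(\<lambda>x. int CARD('a) ^ r * of_bool (x = z)) \<in> flat_span r"
  using assms
proof (induction r)
  case 0
  have "{z} = (\<lambda>v. z + v) ` {0}"
    by simp
  then have "{z} \<in> affine_flats 0"
    unfolding affine_flats_def using vec.subspace_single_0 vec.dim_eq_0 by blast
  from flat_span_flat[OF this] show ?case
    by simp
next
  case (Suc r)
  then have "(\<lambda>x. int CARD('a) * (int CARD('a) ^ r * of_bool (x = z))) \<in> flat_span (Suc r)"
    by (intro flat_span_Suc) auto
  then show ?case
    by (simp add: mult.assoc)
qed

text \<open>This settles the dimension that the induction does not reach; there the lattice contains
  only constant functions.\<close>

lemma affine_flats_CARD:
  "affine_flats CARD('n) = {UNIV :: ('a :: field ^ 'n :: finite) set}"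
proof -
  have "L = UNIV" if "vec.subspace L" "vec.dim L = CARD('n)" for L :: "('a ^ 'n) set"
    using that by (metis vec.dim_eq_full vec.dim_UNIV vec.dimension_def vec.span_eq_iff vec_dim_card)
  moreover have "(\<lambda>v. t + v) ` UNIV = UNIV" for t :: "'a ^ 'n"
    by (auto simp: set_eq_iff mem_translate_iff)
  moreover have "vec.subspace (UNIV :: ('a ^ 'n) set)" "vec.dim (UNIV :: ('a ^ 'n) set) = CARD('n)"
    by (simp_all add: card_cart_basis)
  ultimately show ?thesis
    unfolding affine_flats_def by blast
qed

section \<open>From a matrix identity to the Smith normal form\<close>

text \<open>The hypothesis is invariant under unimodular row and column operations, and for a diagonal
  matrix \<open>S\<close> it reads \<open>s\<^sub>i b\<^sub>i\<^sub>i s\<^sub>i = d s\<^sub>i\<close> on the diagonal.\<close>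

lemma invariant_factor_dvd:
  assumes A: "A \<in> carrier_mat m n" and B: "B \<in> carrier_mat n m"
    and ABA: "A * B * A = d \<cdot>\<^sub>m A" and s: "s \<in> invariant_factors A"
  shows "s dvd d"
proof -
  obtain S i P Q where S: "S = P * A * Q" "diagonal_mat S"
    and P: "P \<in> carrier_mat m m" "invertible_mat P"
    and Q: "Q \<in> carrier_mat n n" "invertible_mat Q"
    and i: "i < min (dim_row S) (dim_col S)" and si: "s = S $$ (i, i)" "s \<noteq> 0"
    using s A by (auto simp: invariant_factors_def smith_normal_form_of_def)
  obtain P' where P': "P' \<in> carrier_mat m m" "P' * P = 1\<^sub>m m"
    using P unfolding invertible_mat_def inverts_mat_def
    by (metis carrier_matD carrier_matI index_mult_mat(2,3) index_one_mat(2,3))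
  obtain Q' where Q': "Q' \<in> carrier_mat n n" "Q * Q' = 1\<^sub>m n"
    using Q unfolding invertible_mat_def inverts_mat_def
    by (metis carrier_matD carrier_matI index_mult_mat(2,3) index_one_mat(2,3))
  \<comment> \<open>\<open>C\<close> is \<open>B\<close> in the changed bases, chosen so that
    \<open>S * C * S\<close> collapses to \<open>P * (A * B * A) * Q\<close>.\<close>
  define C where "C = Q' * B * P'"
  have C: "C \<in> carrier_mat n m" and Sc: "S \<in> carrier_mat m n"
    using P Q P' Q' A B by (auto simp: C_def S)
  \<comment> \<open>Rewriting by associativity needs dimensions fixed in advance, hence one instance
    for each combination of \<open>m\<close> and \<open>n\<close>.\<close>
  have "S * C * S = P * (A * (Q * Q') * B * (P' * P) * A) * Q"
    using P(1) Q(1) P'(1) Q'(1) A B unfolding C_def S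
    by (simp add: assoc_mult_mat[of _ _ m _ m _ m] assoc_mult_mat[of _ _ m _ m _ n]
      assoc_mult_mat[of _ _ m _ n _ m] assoc_mult_mat[of _ _ m _ n _ n]
      assoc_mult_mat[of _ _ n _ m _ m] assoc_mult_mat[of _ _ n _ m _ n]
      assoc_mult_mat[of _ _ n _ n _ m] assoc_mult_mat[of _ _ n _ n _ n])
  also have "\<dots> = P * (d \<cdot>\<^sub>m A) * Q"
    using A B P'(2) Q'(2) ABA by simp
  also have "\<dots> = d \<cdot>\<^sub>m S"
    using A P(1) Q(1) by (simp add: S mult_smult_distrib mult_smult_assoc_mat[of _ m n])
  finally have SCS: "S * C * S = d \<cdot>\<^sub>m S" .
  have im: "i < m" "i < n"
    using i Sc by auto
  have row: "row S i $ k = (if k = i then s else 0)" if "k < n" for k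
    using S(2) Sc im that by (auto simp: si diagonal_mat_def)
  have col: "col S i $ k = (if k = i then s else 0)" if "k < m" for k
    using S(2) Sc im that by (auto simp: si diagonal_mat_def)
  have SC: "(S * C) $$ (i, k) = s * C $$ (i, k)" if "k < m" for k
    using Sc C im that row by (simp add: scalar_prod_def if_distrib[of "\<lambda>x. x * _"] cong: if_cong)
  have "(S * C * S) $$ (i, i) = (\<Sum>k = 0..<m. (S * C) $$ (i, k) * col S i $ k)"
    using Sc C im by (simp only: index_mult_mat(1) dim_row_mat carrier_matD index_mult_mat(2,3))
      (simp add: scalar_prod_def)
  also have "\<dots> = (\<Sum>k = 0..<m. if k = i then s * C $$ (i, i) * s else 0)"
    using SC col by (intro sum.cong) auto
  finally have "(S * C * S) $$ (i, i) = s * C $$ (i, i) * s"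
    using im by simp
  then have "s * C $$ (i, i) * s = d * s"
    using SCS Sc im si by simp
  \<comment> \<open>One factor \<open>s\<close> cancels, since invariant factors are
    nonzero.\<close>
  then show ?thesis
    using si(2) by (metis dvd_triv_left mult_right_cancel)
qed

theorem theorem8p1:
  fixes p q k n r :: nat
    and Ys :: "('a :: {field, finite} ^ 'n :: finite) set list"
    and Zs :: "('a ^ 'n) list"
  assumes "prime p" and "1 \<le> k" and "q = p ^ k"
    and "CARD('a) = q" and "CARD('n) = n" and "1 \<le> n" and "r \<le> n"
    and "distinct Ys" and "set Ys = affine_flats r"
    and "distinct Zs" and "set Zs = UNIV"
  shows "\<forall>d \<in> invariant_factors (incidence_mat Ys Zs). \<exists>e. d = int p ^ e"
proof
  fix s assume s: "s \<in> invariant_factors (incidence_mat Ys Zs)"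
  let ?A = "incidence_mat Ys Zs"
  have A: "?A \<in> carrier_mat (length Ys) (length Zs)"
    by (simp add: incidence_mat_def)
  \<comment> \<open>The form \<open>A * B * A = d A\<close> serves both cases: for
    \<open>r < n\<close> it comes from a left inverse up to \<open>q ^ r\<close>, for
    \<open>r = n\<close> from a right inverse.\<close>
  have "\<exists>B \<in> carrier_mat (length Zs) (length Ys). ?A * B * ?A = int q ^ r \<cdot>\<^sub>m ?A \<or> ?A * B * ?A = 1 \<cdot>\<^sub>m ?A"
  proof (cases "r < n")
    case True
    then have "\<exists>c. \<forall>x. int q ^ r * of_bool (x = z)
        = (\<Sum>Y\<in>affine_flats r. c Y * of_bool (x \<in> Y))" for z :: "'a ^ 'n"
      using flat_span_point[of r z] by (simp only: flat_span_def mem_Collect_eq assms(4,5))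
    then obtain c where c: "\<And>z x :: 'a ^ 'n. int q ^ r * of_bool (x = z)
        = (\<Sum>Y\<in>affine_flats r. c z Y * of_bool (x \<in> Y))"
      by metis
    \<comment> \<open>Row \<open>i\<close> of \<open>B\<close> holds the coefficients that express
      \<open>q ^ r\<close> times the indicator of the point \<open>Zs ! i\<close>.\<close>
    define B where "B = mat (length Zs) (length Ys) (\<lambda>(i, j). c (Zs ! i) (Ys ! j))"
    have B: "B \<in> carrier_mat (length Zs) (length Ys)"
      by (simp add: B_def)
    have "B * ?A = int q ^ r \<cdot>\<^sub>m 1\<^sub>m (length Zs)"
    proof (rule eq_matI)
      fix i j assume "i < dim_row (int q ^ r \<cdot>\<^sub>m 1\<^sub>m (length Zs))"
        "j < dim_col (int q ^ r \<cdot>\<^sub>m 1\<^sub>m (length Zs))"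
      then have ij: "i < length Zs" "j < length Zs"
        by auto
      then have "(B * ?A) $$ (i, j)
          = (\<Sum>k = 0..<length Ys. c (Zs ! i) (Ys ! k) * of_bool (Zs ! j \<in> Ys ! k))"
        by (simp add: B_def incidence_mat_def scalar_prod_def of_bool_def)
      \<comment> \<open>Distinctness of \<open>Ys\<close> makes each flat count once.\<close>
      also have "\<dots> = (\<Sum>Y\<in>set Ys. c (Zs ! i) Y * of_bool (Zs ! j \<in> Y))"
        using assms(8) by (intro sum.reindex_bij_betw bij_betw_nth) auto
      also have "\<dots> = int q ^ r * of_bool (Zs ! j = Zs ! i)"
        using assms(9) c by simp
      finally show "(B * ?A) $$ (i, j) = (int q ^ r \<cdot>\<^sub>m 1\<^sub>m (length Zs)) $$ (i, j)"
        using ij assms(10) by (auto simp: nth_eq_iff_index_eq)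
    qed (auto simp: B_def incidence_mat_def)
    then have "?A * B * ?A = int q ^ r \<cdot>\<^sub>m ?A"
      using A B mult_smult_distrib[OF A one_carrier_mat] by (simp add: assoc_mult_mat)
    then show ?thesis
      using B by blast
  next
    case False
    then have "set Ys = {UNIV}"
      using assms affine_flats_CARD[where ?'a = 'a and ?'n = 'n] by simp
    moreover have "length Ys = 1"
      using calculation assms(8) distinct_card by fastforce
    ultimately have Ys: "Ys = [UNIV]"
      by (auto simp: length_Suc_conv)
    have len: "0 < length Zs"
      using assms(11) by (metis UNIV_not_empty length_greater_0_conv list.set(1))
    \<comment> \<open>\<open>B\<close> selects the first point; every entry of the single row of the
      matrix is 1.\<close>
    define B where "B = mat (length Zs) 1 (\<lambda>(i, j). if i = 0 then 1 else 0 :: int)"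
    have "?A * B = 1\<^sub>m 1"
      using len by (intro eq_matI) (auto simp: B_def incidence_mat_def Ys scalar_prod_def)
    then have "?A * B * ?A = 1 \<cdot>\<^sub>m ?A"
      using A Ys by (intro eq_matI) auto
    then show ?thesis
      using Ys by (intro bexI[of _ B]) (auto simp: B_def)
  qed
  then have "s dvd int q ^ r \<or> s dvd 1"
    using invariant_factor_dvd[OF A _ _ s] by blast
  then have "s dvd int p ^ (k * r)"
    using assms(3) by (metis dvd_trans one_dvd of_nat_power power_mult)
  \<comment> \<open>The sign normalisation of the Smith form rules out \<open>- (p ^ e)\<close> and
    allows passing to natural numbers.\<close>
  moreover have "0 \<le> s"
    using s by (auto simp: invariant_factors_def smith_normal_form_of_def)
  ultimately have "nat s dvd p ^ (k * r)"
    by (metis int_nat_eq int_dvd_int_iff of_nat_power)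
  then obtain e where "nat s = p ^ e"
    using assms(1) divides_primepow_nat by blast
  then show "\<exists>e. s = int p ^ e"
    using \<open>0 \<le> s\<close> by (metis int_nat_eq of_nat_power)
qed

end
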